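(* Let $a,b,c\in\mathbb{Z}^{+}$ and consider the five forms (1) $ax^2+by^2+cT_z$, (2) $aT_x+bT_y+cz^2$, (3) $aT_x+bT_y+cT_z$, (4) $ax^2+bT_y+cz^2$, (5) $ax^2+bT_y+cT_z$. (i) If $a'\equiv b'\equiv -c'\pmod 8$, then none of (1)-(5) is asymptotically universal. (ii) If either - $a'\equiv b'\equiv c'+4\pmod 8$ and $v_2(a)\not\equiv v_2(b)\pmod 2$, or - $\varepsilon a'\equiv -b'\equiv c'+4\pmod 8$ for some sign $\varepsilon\in\{1,-1\}$ and $v_2(a)\equiv v_2(b)\pmod 2$, then none of (1)-(3) is asymptotically universal. (iii) If either - $a'\equiv b'\equiv c'+4\pmod 8$ and $v_2(a)\equiv v_2(b)\pmod 2$, or - $\varepsilon a'\equiv -b'\equiv c'+4\pmod 8$ for some sign $\varepsilon\in\{1,-1\}$ and $v_2(a)\not\equiv v_2(b)\pmod 2$, then neither (4) nor (5) is asymptotically universal.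
   Context: $\mathbb{Z}^{+}=\{1,2,3,\ldots\}$. For $x\in\mathbb{Z}$, $T_x=x(x+1)/2$. A form $f(x,y,z)$ of one of the listed types (variables ranging over $\mathbb{Z}$) is asymptotically universal if $\lim_{N\to\infty}\frac1N|\{1\le n\le N: n=f(x,y,z)\text{ for some }x,y,z\in\mathbb{Z}\}|=1$. For a positive integer $n$, $v_2(n)$ is the 2-adic order of $n$ and $n'=n/2^{v_2(n)}$ is the odd part of $n$. *)

theory Defs
  imports Complex_Main "HOL-Number_Theory.Cong" "HOL-Computational_Algebra.Factorial_Ring"
begin

definition triangular :: "int \<Rightarrow> int" where
  "triangular x = x * (x + 1) div 2"

definition asymptotically_universal :: "(int \<Rightarrow> int \<Rightarrow> int \<Rightarrow> int) \<Rightarrow> bool" where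
  "asymptotically_universal f \<longleftrightarrow>
     (\<lambda>N::nat. real (card {n::nat. 1 \<le> n \<and> n \<le> N \<and> (\<exists>x y z. int n = f x y z)}) / real N)
       \<longlonglongrightarrow> 1"

abbreviation v2 :: "int \<Rightarrow> nat" where
  "v2 n \<equiv> multiplicity 2 n"

definition odd_part :: "int \<Rightarrow> int" where
  "odd_part n = n div 2 ^ v2 n"

definition form1 :: "int \<Rightarrow> int \<Rightarrow> int \<Rightarrow> int \<Rightarrow> int \<Rightarrow> int \<Rightarrow> int" where
  "form1 a b c x y z = a * x^2 + b * y^2 + c * triangular z"

definition form2 :: "int \<Rightarrow> int \<Rightarrow> int \<Rightarrow> int \<Rightarrow> int \<Rightarrow> int \<Rightarrow> int" where
  "form2 a b c x y z = a * triangular x + b * triangular y + c * z^2"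

definition form3 :: "int \<Rightarrow> int \<Rightarrow> int \<Rightarrow> int \<Rightarrow> int \<Rightarrow> int \<Rightarrow> int" where
  "form3 a b c x y z = a * triangular x + b * triangular y + c * triangular z"

definition form4 :: "int \<Rightarrow> int \<Rightarrow> int \<Rightarrow> int \<Rightarrow> int \<Rightarrow> int \<Rightarrow> int" where
  "form4 a b c x y z = a * x^2 + b * triangular y + c * z^2"

definition form5 :: "int \<Rightarrow> int \<Rightarrow> int \<Rightarrow> int \<Rightarrow> int \<Rightarrow> int \<Rightarrow> int" where
  "form5 a b c x y z = a * x^2 + b * triangular y + c * triangular z"

end

theory Submission
  imports Defs "HOL-Number_Theory.Quadratic_Reciprocity"
begin

text \<open>
  Completing the squares turns each form into a positive definite diagonal form
  \<open>A X\<^sup>2 + B Y\<^sup>2 + C Z\<^sup>2\<close>. It is anisotropic over the reals, and the hypotheses make it isotropic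
  over the 2-adic numbers. By the product formula for the Hilbert symbols of \<open>- A C\<close> and \<open>- B C\<close>, that is,
  quadratic reciprocity, it is then anisotropic over the \<open>p\<close>-adic numbers for some odd prime \<open>p\<close>. An anisotropic
  ternary form misses a whole residue class modulo some power of \<open>p\<close>; since 2 is invertible modulo
  \<open>p\<close>, so does the original form, whose values therefore have upper density less than 1.
\<close>

subsection \<open>The Legendre symbol\<close>

lemma Legendre_range: "Legendre a p \<in> {-1, 0, 1}"
  by (simp add: Legendre_def)

lemma Legendre_cases:
  assumes "\<not> p dvd a"
  shows "Legendre a p = 1 \<or> Legendre a p = -1"
  using assms by (auto simp: Legendre_def cong_0_iff)

text \<open>Two elements of {-1, 0, 1} differ by at most 2, which is less than \<open>p\<close>.
  This turns the congruences of Euler's criterion into equalities of signs.\<close>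

lemma cong_small_int_eq:
  fixes x y p :: int
  assumes "[x = y] (mod p)" "x \<in> {-1, 0, 1}" "y \<in> {-1, 0, 1}" "p > 2"
  shows "x = y"
proof -
  from assms(1) have "p dvd x - y" by (simp add: cong_iff_dvd_diff)
  moreover have "\<bar>x - y\<bar> < p" using assms by auto
  ultimately show ?thesis using zdvd_imp_le[of p "\<bar>x - y\<bar>"] by force
qed

lemma odd_prime_gt_2_int: "prime (p::int) \<Longrightarrow> odd p \<Longrightarrow> p > 2"
  using prime_gt_1_int[of p] by (cases "p = 2") auto

lemma euler_criterion_int:
  assumes "prime (p::int)" "odd p"
  shows "[Legendre a p = a ^ nat ((p - 1) div 2)] (mod p)"
proof -
  have "prime (nat p)" "2 < nat p" "int (nat p) = p"
    using assms odd_prime_gt_2_int[OF assms] by auto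
  moreover have "(nat p - 1) div 2 = nat ((p - 1) div 2)"
    using odd_prime_gt_2_int[OF assms] by linarith
  ultimately show ?thesis using euler_criterion[of "nat p" a] by simp
qed

text \<open>By Euler's criterion both sides are congruent to
  \<open>(a * b) ^ nat ((p - 1) div 2)\<close> modulo \<open>p\<close>.\<close>

lemma Legendre_mult:
  assumes "prime (p::int)" "odd p"
  shows "Legendre (a * b) p = Legendre a p * Legendre b p"
proof (rule cong_small_int_eq)
  have "[Legendre a p * Legendre b p = (a * b) ^ nat ((p - 1) div 2)] (mod p)"
    unfolding power_mult_distrib by (intro cong_mult euler_criterion_int assms)
  then show "[Legendre (a * b) p = Legendre a p * Legendre b p] (mod p)"
    using euler_criterion_int[OF assms, of "a * b"] cong_sym cong_trans by blast
qed (use Legendre_range[of a p] Legendre_range[of b p] Legendre_range[of "a * b" p]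
      odd_prime_gt_2_int[OF assms] in auto)

lemma Legendre_square:
  assumes "prime (p::int)" "\<not> p dvd a"
  shows "Legendre (a * a) p = 1"
proof -
  have "QuadRes p (a * a)" unfolding QuadRes_def power2_eq_square by (rule exI[of _ a]) simp
  then show ?thesis using assms by (simp add: Legendre_def cong_0_iff prime_dvd_mult_iff)
qed

lemma Legendre_one: "prime (p::int) \<Longrightarrow> Legendre 1 p = 1"
  using Legendre_square[of p 1] by (auto simp: not_prime_unit)

text \<open>Squaring on the finite set of residues is not injective, since 1 and
  \<open>p - 1\<close> have the same square; hence it is not surjective.\<close>

lemma exists_nonresidue:
  assumes "prime (p::int)" "odd p"
  obtains t where "\<not> QuadRes p t"
proof -
  have "\<exists>t. \<not> QuadRes p t"
  proof (rule ccontr)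
    assume "\<not> (\<exists>t. \<not> QuadRes p t)"
    then have all: "QuadRes p t" for t by blast
    define S where "S = {0..<p}"
    have p2: "p > 2" using odd_prime_gt_2_int assms by blast
    have "S \<subseteq> (\<lambda>x. x\<^sup>2 mod p) ` S"
    proof
      fix t assume t: "t \<in> S"
      obtain y where "[y\<^sup>2 = t] (mod p)" using all unfolding QuadRes_def by blast
      then have "(y mod p)\<^sup>2 mod p = t" using t by (auto simp: cong_def S_def power_mod)
      moreover have "y mod p \<in> S" using p2 by (simp add: S_def)
      ultimately show "t \<in> (\<lambda>x. x\<^sup>2 mod p) ` S" by blast
    qed
    then have "inj_on (\<lambda>x. x\<^sup>2 mod p) S"
      by (intro finite_surj_inj) (simp_all add: S_def)
    moreover have "1\<^sup>2 mod p = (p - 1)\<^sup>2 mod p"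
    proof -
      have "(p - 1)\<^sup>2 = 1 + p * (p - 2)" by (simp add: power2_eq_square algebra_simps)
      then show ?thesis by simp
    qed
    ultimately have "1 = p - 1" using p2 by (elim inj_onD) (auto simp: S_def)
    then show False using p2 by simp
  qed
  then show ?thesis using that by blast
qed

subsection \<open>Quadratic reciprocity and its supplements\<close>

text \<open>For odd arguments this is the reciprocity sign, -1 to the power
  \<open>((u - 1) div 2) * ((w - 1) div 2)\<close>.\<close>

definition mod4_sign :: "int \<Rightarrow> int \<Rightarrow> int" where
  "mod4_sign u w = (if u mod 4 = 3 \<and> w mod 4 = 3 then -1 else 1)"

text \<open>For odd \<open>u\<close> this is -1 to the power \<open>(u * u - 1) div 8\<close>, the
  sign in the second supplement to reciprocity.\<close>

definition mod8_sign :: "int \<Rightarrow> int" where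
  "mod8_sign u = (if u mod 8 \<in> {1, 7} then 1 else -1)"

lemma Legendre_minus_one:
  assumes "prime (p::int)" "odd p"
  shows "Legendre (-1) p = mod4_sign (-1) p"
proof -
  have "[Legendre (-1) p = (-1) ^ nat ((p - 1) div 2)] (mod p)"
    by (rule euler_criterion_int[OF assms])
  moreover have "(-1::int) ^ nat ((p - 1) div 2) = mod4_sign (-1) p"
  proof (cases "p mod 4 = 3")
    case True
    then have "odd ((p - 1) div 2)" by presburger
    then have "odd (nat ((p - 1) div 2))"
      using odd_prime_gt_2_int[OF assms] by (simp add: even_nat_iff)
    then show ?thesis using True by (simp add: mod4_sign_def)
  next
    case False
    then have "even ((p - 1) div 2)" using assms(2) by presburger
    then have "even (nat ((p - 1) div 2))"
      using odd_prime_gt_2_int[OF assms] by (simp add: even_nat_iff)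
    then show ?thesis using False by (simp add: mod4_sign_def)
  qed
  ultimately show ?thesis
    using cong_small_int_eq Legendre_range[of "-1" p] odd_prime_gt_2_int[OF assms]
    by (metis insertCI mod4_sign_def)
qed

text \<open>Gauss's lemma with multiplier 2: the symbol is the parity of the number of doubled
  residues that exceed \<open>(p - 1) div 2\<close>.\<close>

lemma Legendre_two:
  assumes "prime (p::int)" "odd p"
  shows "Legendre 2 p = mod8_sign p"
proof -
  define q where "q = nat p"
  have q: "int q = p" and p2: "p > 2"
    using odd_prime_gt_2_int[OF assms] by (auto simp: q_def)
  interpret GAUSS q 2
    using assms q p2 by unfold_locales (auto simp: q_def cong_0_iff dest: zdvd_imp_le)
  \<comment> \<open>Doubling a residue up to \<open>(p - 1) div 2\<close> stays below
    \<open>p\<close>, so nothing is reduced modulo \<open>p\<close>; the double lies in the upper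
    half exactly when the residue exceeds \<open>(p - 1) div 4\<close>.\<close>
  have "E = (\<lambda>x. 2 * x) ` {(p - 1) div 4 <.. (p - 1) div 2}" (is "_ = ?R")
  proof
    have C: "C = (\<lambda>x. 2 * x) ` {0 <.. (p - 1) div 2}"
      unfolding C_def B_def A_def q image_image using p2
      by (intro image_cong) (auto intro!: mod_pos_pos_trivial)
    show "E \<subseteq> ?R"
    proof
      fix x assume "x \<in> E"
      then obtain t where t: "x = 2 * t" "0 < t" "t \<le> (p - 1) div 2" "2 * t > (p - 1) div 2"
        unfolding E_def C q by auto
      then have "t > (p - 1) div 4" by linarith
      with t show "x \<in> ?R" by auto
    qed
    show "?R \<subseteq> E"
    proof
      fix x assume "x \<in> ?R"
      then obtain t where t: "x = 2 * t" "t \<le> (p - 1) div 2" "t > (p - 1) div 4"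
        by auto
      then have "2 * t > (p - 1) div 2" "t > 0" using p2 by linarith+
      with t show "x \<in> E" unfolding E_def C q by auto
    qed
  qed
  then have "card E = nat ((p - 1) div 2 - (p - 1) div 4)"
    by (simp add: card_image inj_on_def)
  moreover have "even (nat ((p - 1) div 2 - (p - 1) div 4)) \<longleftrightarrow> p mod 8 \<in> {1, 7}"
  proof -
    have "(p - 1) div 2 - (p - 1) div 4 \<ge> 0" using p2 by linarith
    then have "even (nat ((p - 1) div 2 - (p - 1) div 4)) \<longleftrightarrow>
        even ((p - 1) div 2 - (p - 1) div 4)"
      by (simp only: even_nat_iff)
    also have "\<dots> \<longleftrightarrow> p mod 8 = 1 \<or> p mod 8 = 7"
    proof -
      \<comment> \<open>The summands \<open>4 * k\<close> and \<open>2 * k\<close> are even, so only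
        the remainder \<open>r\<close> modulo 8 affects the parity.\<close>
      obtain k r where "p = 8 * k + r" "r \<in> {1, 3, 5, 7}"
      proof (rule that)
        show "p = 8 * (p div 8) + p mod 8" by simp
        show "p mod 8 \<in> {1, 3, 5, 7}" using assms(2) unfolding insert_iff empty_iff by presburger
      qed
      moreover from this have "(p - 1) div 2 = 4 * k + (r - 1) div 2"
          "(p - 1) div 4 = 2 * k + (r - 1) div 4" by auto
      ultimately show ?thesis by auto
    qed
    finally show ?thesis by simp
  qed
  ultimately show ?thesis using gauss_lemma unfolding q mod8_sign_def by simp
qed

lemma Legendre_reciprocity:
  assumes "prime (p::int)" "odd p" "prime q" "odd q" "p \<noteq> q"
  shows "Legendre p q * Legendre q p = mod4_sign p q"
proof -
  have gt: "p > 2" "q > 2" using assms odd_prime_gt_2_int by auto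
  have "Legendre (int (nat p)) (int (nat q)) * Legendre (int (nat q)) (int (nat p)) =
      (-1) ^ nat ((int (nat p) - 1) div 2 * ((int (nat q) - 1) div 2))"
    by (rule Quadratic_Reciprocity_int) (use assms gt in auto)
  then have "Legendre p q * Legendre q p = (-1) ^ nat ((p - 1) div 2 * ((q - 1) div 2))"
    using gt by simp
  moreover have "even (nat ((p - 1) div 2 * ((q - 1) div 2))) \<longleftrightarrow>
      even ((p - 1) div 2) \<or> even ((q - 1) div 2)"
    using gt by (simp add: even_nat_iff pos_imp_zdiv_nonneg_iff)
  moreover have "even ((t - 1) div 2) \<longleftrightarrow> t mod 4 \<noteq> 3" if "odd t" for t :: int
    using that by presburger
  ultimately show ?thesis using assms by (simp add: mod4_sign_def)
qed

section \<open>Multiplicativity and symmetry of the signs modulo 4 and 8\<close>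

lemma mod4_sign_mult:
  assumes "odd u" "odd v"
  shows "mod4_sign (u * v) w = mod4_sign u w * mod4_sign v w"
proof -
  have "u mod 4 \<in> {1, 3}" "v mod 4 \<in> {1, 3}"
    using assms unfolding insert_iff empty_iff by presburger+
  moreover have "u * v mod 4 = x * y mod 4" if "u mod 4 = x" "v mod 4 = y" for x y
    using mod_mult_eq[of u 4 v] that by simp
  ultimately show ?thesis unfolding mod4_sign_def by (elim insertE emptyE) simp_all
qed

lemma mod4_sign_commute: "mod4_sign u w = mod4_sign w u"
  by (simp add: mod4_sign_def conj_commute)

lemma mod8_sign_mult:
  assumes "odd u" "odd v"
  shows "mod8_sign (u * v) = mod8_sign u * mod8_sign v"
proof -
  have "u mod 8 \<in> {1, 3, 5, 7}" "v mod 8 \<in> {1, 3, 5, 7}"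
    using assms unfolding insert_iff empty_iff by presburger+
  moreover have "u * v mod 8 = x * y mod 8" if "u mod 8 = x" "v mod 8 = y" for x y
    using mod_mult_eq[of u 8 v] that by simp
  ultimately show ?thesis unfolding mod8_sign_def by (elim insertE emptyE) simp_all
qed

subsection \<open>Hilbert symbols and their product formula\<close>

text \<open>The \<open>p\<close>-adic unit cofactor of \<open>n\<close>; at 2 it agrees with
  \<open>odd_part\<close>.\<close>

definition unit_part :: "int \<Rightarrow> int \<Rightarrow> int" where
  "unit_part p n = n div p ^ multiplicity p n"

lemma unit_part_decompose: "n = p ^ multiplicity p n * unit_part p n"
  by (simp add: unit_part_def multiplicity_dvd)

lemma unit_part_not_dvd: "prime p \<Longrightarrow> n \<noteq> 0 \<Longrightarrow> \<not> p dvd unit_part p n"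
  unfolding unit_part_def by (rule multiplicity_decompose) (auto simp: not_prime_unit)

lemma multiplicity_prime_mult:
  "prime (p::int) \<Longrightarrow> m \<noteq> 0 \<Longrightarrow> n \<noteq> 0 \<Longrightarrow>
    multiplicity p (m * n) = multiplicity p m + multiplicity p n"
  by (intro prime_elem_multiplicity_mult_distrib prime_imp_prime_elem)

lemma unit_part_mult:
  assumes "prime p" "m \<noteq> 0" "n \<noteq> 0"
  shows "unit_part p (m * n) = unit_part p m * unit_part p n"
  unfolding unit_part_def multiplicity_prime_mult[OF assms] power_add
  by (intro div_mult_div_if_dvd[symmetric] multiplicity_dvd)

lemma unit_part_eq_self: "\<not> p dvd n \<Longrightarrow> unit_part p n = n"
  by (simp add: unit_part_def not_dvd_imp_multiplicity_0)

lemma unit_part_self: "prime p \<Longrightarrow> unit_part p p = 1"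
  using multiplicity_prime[OF prime_imp_prime_elem[of p]] by (auto simp: unit_part_def)

lemma unit_part_uminus: "unit_part p (- n) = - unit_part p n"
  "multiplicity p (- n :: int) = multiplicity p n"
  using multiplicity_times_unit_right[of "-1" p n]
  by (simp_all add: unit_part_def dvd_neg_div multiplicity_dvd)

lemma odd_part_eq_unit_part: "odd_part n = unit_part 2 n"
  by (simp add: odd_part_def unit_part_def)

text \<open>
  The local Hilbert symbols for nonzero arguments. The usual quotient of powers inside the Legendre
  symbol is written as a product of symbols, since each of them is a sign.
\<close>

definition hilbert_odd :: "int \<Rightarrow> int \<Rightarrow> int \<Rightarrow> int" where
  "hilbert_odd p m n =
     Legendre (-1) p ^ (multiplicity p m * multiplicity p n) *
     Legendre (unit_part p m) p ^ multiplicity p n * Legendre (unit_part p n) p ^ multiplicity p m"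

definition hilbert_two :: "int \<Rightarrow> int \<Rightarrow> int" where
  "hilbert_two m n =
     mod4_sign (unit_part 2 m) (unit_part 2 n) *
     mod8_sign (unit_part 2 m) ^ multiplicity 2 n * mod8_sign (unit_part 2 n) ^ multiplicity 2 m"

definition hilbert_real :: "int \<Rightarrow> int \<Rightarrow> int" where
  "hilbert_real m n = (if m < 0 \<and> n < 0 then -1 else 1)"

lemma hilbert_odd_commute: "hilbert_odd p m n = hilbert_odd p n m"
  by (simp add: hilbert_odd_def mult_ac)

lemma hilbert_two_commute: "hilbert_two m n = hilbert_two n m"
  by (simp add: hilbert_two_def mod4_sign_commute[of "unit_part 2 m"] mult_ac)

lemma hilbert_real_commute: "hilbert_real m n = hilbert_real n m"
  by (simp add: hilbert_real_def)

lemma hilbert_odd_mult: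
  assumes "prime p" "odd p" "m \<noteq> 0" "m' \<noteq> 0"
  shows "hilbert_odd p (m * m') n = hilbert_odd p m n * hilbert_odd p m' n"
  using assms
  by (simp add: hilbert_odd_def multiplicity_prime_mult unit_part_mult Legendre_mult
      power_mult_distrib power_add algebra_simps)

lemma hilbert_two_mult:
  assumes "m \<noteq> 0" "m' \<noteq> 0"
  shows "hilbert_two (m * m') n = hilbert_two m n * hilbert_two m' n"
proof -
  have "odd (unit_part 2 m)" "odd (unit_part 2 m')"
    using assms unit_part_not_dvd[of 2] by auto
  then show ?thesis using assms
    by (simp add: hilbert_two_def multiplicity_prime_mult unit_part_mult mod4_sign_mult
        mod8_sign_mult power_mult_distrib power_add algebra_simps)
qed

lemma hilbert_real_mult:
  "m \<noteq> 0 \<Longrightarrow> m' \<noteq> 0 \<Longrightarrow> hilbert_real (m * m') n = hilbert_real m n * hilbert_real m' n"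
  by (auto simp: hilbert_real_def mult_less_0_iff)

lemma hilbert_odd_range:
  assumes "prime p" "m \<noteq> 0" "n \<noteq> 0"
  shows "hilbert_odd p m n = 1 \<or> hilbert_odd p m n = -1"
proof -
  have "\<not> p dvd -1" using assms(1) by (auto simp: not_prime_unit)
  have pm: "x ^ k = 1 \<or> x ^ k = -1" if "x = 1 \<or> x = -1" for x :: int and k :: nat
    using that by (cases "even k") auto
  have "Legendre (-1) p ^ k = 1 \<or> Legendre (-1) p ^ k = -1"
    "Legendre (unit_part p m) p ^ k = 1 \<or> Legendre (unit_part p m) p ^ k = -1"
    "Legendre (unit_part p n) p ^ k = 1 \<or> Legendre (unit_part p n) p ^ k = -1" for k
    using \<open>\<not> p dvd -1\<close> assms by (intro pm Legendre_cases unit_part_not_dvd; simp)+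
  then show ?thesis unfolding hilbert_odd_def
    by (metis mult_1 mult_1_right mult_minus1 mult_minus1_right minus_minus)
qed

text \<open>Extra odd primes are allowed, so that a set chosen for a product serves each of its
  factors too. At an extra prime both arguments of the symbol are units and the symbol is 1.\<close>

definition covers_odd_primes :: "int set \<Rightarrow> int \<Rightarrow> bool" where
  "covers_odd_primes P n \<longleftrightarrow> finite P \<and> (\<forall>p\<in>P. prime p \<and> odd p) \<and>
     (\<forall>p. prime p \<and> odd p \<and> p dvd n \<longrightarrow> p \<in> P)"

lemma covers_odd_primesD:
  assumes "covers_odd_primes P n"
  shows "finite P" "p \<in> P \<Longrightarrow> prime p" "p \<in> P \<Longrightarrow> odd p"
    "prime p \<Longrightarrow> odd p \<Longrightarrow> p dvd n \<Longrightarrow> p \<in> P"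
  using assms unfolding covers_odd_primes_def by blast+

lemma covers_odd_primes_dvd:
  "covers_odd_primes P n \<Longrightarrow> m dvd n \<Longrightarrow> covers_odd_primes P m"
  unfolding covers_odd_primes_def using dvd_trans by blast

text \<open>Hilbert's reciprocity law with the symbols at 2 and at the real place moved to the
  right-hand side, which is harmless since they are signs.\<close>

definition product_formula :: "int \<Rightarrow> int \<Rightarrow> bool" where
  "product_formula m n \<longleftrightarrow> (\<forall>P. covers_odd_primes P (m * n) \<longrightarrow>
     (\<Prod>p\<in>P. hilbert_odd p m n) = hilbert_two m n * hilbert_real m n)"

lemma product_formula_commute: "product_formula m n \<longleftrightarrow> product_formula n m"
  unfolding product_formula_def mult.commute[of m n] hilbert_odd_commute[of _ m n]
    hilbert_two_commute[of m n] hilbert_real_commute[of m n] ..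

text \<open>Every local symbol is multiplicative in its first argument, and one set \<open>P\<close>
  covers both factors.\<close>

lemma product_formula_mult:
  assumes "product_formula m n" "product_formula m' n" "m \<noteq> 0" "m' \<noteq> 0"
  shows "product_formula (m * m') n"
  unfolding product_formula_def
proof (intro allI impI)
  fix P assume P: "covers_odd_primes P (m * m' * n)"
  then have "covers_odd_primes P (m * n)" "covers_odd_primes P (m' * n)"
    using covers_odd_primes_dvd by auto
  then have "(\<Prod>p\<in>P. hilbert_odd p m n) * (\<Prod>p\<in>P. hilbert_odd p m' n) =
      (hilbert_two m n * hilbert_real m n) * (hilbert_two m' n * hilbert_real m' n)"
    using assms unfolding product_formula_def by simp
  moreover have "(\<Prod>p\<in>P. hilbert_odd p (m * m') n) =
      (\<Prod>p\<in>P. hilbert_odd p m n * hilbert_odd p m' n)"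
    using covers_odd_primesD(2,3)[OF P] assms by (intro prod.cong refl hilbert_odd_mult)
  ultimately show "(\<Prod>p\<in>P. hilbert_odd p (m * m') n) =
      hilbert_two (m * m') n * hilbert_real (m * m') n"
    using assms by (simp add: prod.distrib hilbert_two_mult hilbert_real_mult mult_ac)
qed

lemma hilbert_odd_units:
  assumes "\<not> p dvd m" "\<not> p dvd n"
  shows "hilbert_odd p m n = 1"
  using assms by (simp add: hilbert_odd_def not_dvd_imp_multiplicity_0)

lemma hilbert_odd_prime_unit:
  assumes "prime p" "odd p" "\<not> p dvd n"
  shows "hilbert_odd p p n = Legendre n p"
proof -
  have "multiplicity p p = 1" "multiplicity p n = 0"
    using multiplicity_prime[OF prime_imp_prime_elem] not_dvd_imp_multiplicity_0 assms by blast+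
  then show ?thesis unfolding hilbert_odd_def by (simp add: unit_part_eq_self assms(3))
qed

lemma prod_hilbert_odd_unit:
  assumes "covers_odd_primes P (m * n)" "\<And>p. p \<in> P \<Longrightarrow> \<not> p dvd m \<and> \<not> p dvd n"
  shows "(\<Prod>p\<in>P. hilbert_odd p m n) = 1"
  using assms by (intro prod.neutral) (auto simp: hilbert_odd_units)

lemma primes_not_dvd_int: "prime (p::int) \<Longrightarrow> prime q \<Longrightarrow> p \<noteq> q \<Longrightarrow> \<not> p dvd q"
  using primes_dvd_imp_eq by blast

lemma odd_prime_not_dvd_two: "prime (p::int) \<Longrightarrow> odd p \<Longrightarrow> \<not> p dvd 2"
  using zdvd_imp_le[of p 2] odd_prime_gt_2_int[of p] by linarith

lemma not_prime_dvd_minus_one: "prime (p::int) \<Longrightarrow> \<not> p dvd -1"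
  by (auto simp: not_prime_unit)

section \<open>The product formula on units and primes\<close>

lemma product_formula_one: "n \<noteq> 0 \<Longrightarrow> product_formula 1 n"
  unfolding product_formula_def
proof (intro allI impI)
  fix P assume "covers_odd_primes P (1 * n)"
  then have "(\<Prod>p\<in>P. hilbert_odd p 1 n) = 1"
    using covers_odd_primesD(2)
    by (intro prod.neutral) (simp add: hilbert_odd_def unit_part_def Legendre_one)
  then show "(\<Prod>p\<in>P. hilbert_odd p 1 n) = hilbert_two 1 n * hilbert_real 1 n"
    by (simp add: hilbert_two_def hilbert_real_def unit_part_def mod4_sign_def mod8_sign_def)
qed

lemma product_formula_minus_one_minus_one: "product_formula (-1) (-1)"
  unfolding product_formula_def
proof (intro allI impI)
  fix P assume P: "covers_odd_primes P (-1 * -1)"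
  have "(\<Prod>p\<in>P. hilbert_odd p (-1) (-1)) = 1"
    using P not_prime_dvd_minus_one
      covers_odd_primesD(2)[OF P]
    by (intro prod_hilbert_odd_unit) auto
  then show "(\<Prod>p\<in>P. hilbert_odd p (-1) (-1)) = hilbert_two (-1) (-1) * hilbert_real (-1) (-1)"
    by (simp add: hilbert_two_def hilbert_real_def unit_part_def not_dvd_imp_multiplicity_0
        mod4_sign_def)
qed

text \<open>Away from \<open>q\<close> both arguments are units, so a single factor
  survives.\<close>

lemma prod_hilbert_odd_one_prime:
  assumes "covers_odd_primes P (m * n)" "prime q" "odd q" "q dvd m * n"
    "\<And>p. prime p \<Longrightarrow> odd p \<Longrightarrow> p \<noteq> q \<Longrightarrow> \<not> p dvd m \<and> \<not> p dvd n"
  shows "(\<Prod>p\<in>P. hilbert_odd p m n) = hilbert_odd q m n"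
proof -
  have "q \<in> P" "finite P" using assms covers_odd_primesD by blast+
  moreover have "(\<Prod>p\<in>P - {q}. hilbert_odd p m n) = 1"
    using covers_odd_primesD(2,3)[OF assms(1)] assms(5)
    by (intro prod.neutral) (auto intro!: hilbert_odd_units)
  ultimately show ?thesis by (simp add: prod.remove)
qed

text \<open>For odd \<open>q\<close> this is the first supplement to reciprocity; for
  \<open>q = 2\<close> every symbol involved is 1.\<close>

lemma product_formula_prime_minus_one:
  assumes q: "prime q"
  shows "product_formula q (-1)"
  unfolding product_formula_def
proof (intro allI impI)
  fix P assume P: "covers_odd_primes P (q * -1)"
  have q0: "q > 0" using q by (simp add: prime_gt_0_int)
  show "(\<Prod>p\<in>P. hilbert_odd p q (-1)) = hilbert_two q (-1) * hilbert_real q (-1)"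
  proof (cases "q = 2")
    case True
    have "(\<Prod>p\<in>P. hilbert_odd p q (-1)) = 1"
    proof (rule prod_hilbert_odd_unit[OF P])
      show "\<not> p dvd q \<and> \<not> p dvd -1" if "p \<in> P" for p
        unfolding True using covers_odd_primesD(2,3)[OF P that]
        by (intro conjI odd_prime_not_dvd_two not_prime_dvd_minus_one)
    qed
    then show ?thesis using True
      by (simp add: hilbert_two_def hilbert_real_def unit_part_def not_dvd_imp_multiplicity_0
        mod4_sign_def mod8_sign_def)
  next
    case False
    then have odd: "odd q" using q primes_not_dvd_int[of 2 q] by auto
    have "(\<Prod>p\<in>P. hilbert_odd p q (-1)) = hilbert_odd q q (-1)"
      using P q odd not_prime_dvd_minus_one primes_not_dvd_int
      by (intro prod_hilbert_odd_one_prime) auto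
    also have "\<dots> = mod4_sign (-1) q"
      using q odd not_prime_dvd_minus_one Legendre_minus_one by (simp add: hilbert_odd_prime_unit)
    finally show ?thesis using odd q0
      by (simp add: hilbert_two_def hilbert_real_def unit_part_def not_dvd_imp_multiplicity_0
        mod4_sign_commute)
  qed
qed

text \<open>For odd \<open>q\<close> this is the second supplement to reciprocity; for
  \<open>q = 2\<close> every symbol involved is 1.\<close>

lemma product_formula_two_prime:
  assumes q: "prime q"
  shows "product_formula 2 q"
  unfolding product_formula_def
proof (intro allI impI)
  fix P assume P: "covers_odd_primes P (2 * q)"
  have q0: "q > 0" using q by (simp add: prime_gt_0_int)
  show "(\<Prod>p\<in>P. hilbert_odd p 2 q) = hilbert_two 2 q * hilbert_real 2 q"
  proof (cases "q = 2")
    case True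
    have "(\<Prod>p\<in>P. hilbert_odd p 2 q) = 1"
    proof (rule prod_hilbert_odd_unit[OF P])
      show "\<not> p dvd 2 \<and> \<not> p dvd q" if "p \<in> P" for p
        unfolding True using covers_odd_primesD(2,3)[OF P that]
        by (intro conjI odd_prime_not_dvd_two)
    qed
    then show ?thesis using True
      by (simp add: hilbert_two_def hilbert_real_def unit_part_self mod4_sign_def mod8_sign_def)
  next
    case False
    then have odd: "odd q" using q primes_not_dvd_int[of 2 q] by auto
    have "(\<Prod>p\<in>P. hilbert_odd p 2 q) = hilbert_odd q 2 q"
      using P q odd primes_not_dvd_int[of _ 2] primes_not_dvd_int[of _ q]
      by (intro prod_hilbert_odd_one_prime) auto
    also have "\<dots> = mod8_sign q"
      using q odd primes_not_dvd_int[of q 2] False Legendre_two hilbert_odd_prime_unit[of q 2]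
      by (simp add: hilbert_odd_commute[of q 2])
    finally show ?thesis using odd q0
      by (simp add: hilbert_two_def hilbert_real_def unit_part_self unit_part_eq_self
          not_dvd_imp_multiplicity_0 mod4_sign_def)
  qed
qed

text \<open>For distinct primes the factors at \<open>q\<close> and \<open>r\<close> are the two
  Legendre symbols of the reciprocity law. For \<open>q = r\<close> the only factor is the Legendre
  symbol of -1, so the first supplement applies.\<close>

lemma product_formula_odd_primes:
  assumes q: "prime q" "odd q" and r: "prime r" "odd r"
  shows "product_formula q r"
  unfolding product_formula_def
proof (intro allI impI)
  fix P assume P: "covers_odd_primes P (q * r)"
  have pos: "q > 0" "r > 0" using q r by (auto simp: prime_gt_0_int)
  then have rhs: "hilbert_two q r * hilbert_real q r = mod4_sign q r"
    using q r by (simp add: hilbert_two_def hilbert_real_def unit_part_eq_self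
        not_dvd_imp_multiplicity_0)
  have "(\<Prod>p\<in>P. hilbert_odd p q r) = mod4_sign q r"
  proof (cases "q = r")
    case True
    have "(\<Prod>p\<in>P. hilbert_odd p q r) = hilbert_odd q q r"
      using P q r primes_not_dvd_int True
      by (intro prod_hilbert_odd_one_prime) auto
    also have "\<dots> = mod4_sign q r"
      using q True Legendre_minus_one[of q] multiplicity_prime[OF prime_imp_prime_elem[of q]]
      by (simp add: hilbert_odd_def unit_part_self Legendre_one mod4_sign_def)
    finally show ?thesis .
  next
    case False
    have fin: "finite P" "q \<in> P" "r \<in> P" using q r covers_odd_primesD[OF P] by auto
    have "(\<Prod>p\<in>P - {q} - {r}. hilbert_odd p q r) = 1"
      using covers_odd_primesD(2)[OF P] q r primes_not_dvd_int
      by (intro prod.neutral ballI hilbert_odd_units) auto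
    then have "(\<Prod>p\<in>P. hilbert_odd p q r) = hilbert_odd q q r * hilbert_odd r q r"
      using fin False prod.remove[of P q "\<lambda>p. hilbert_odd p q r"]
        prod.remove[of "P - {q}" r "\<lambda>p. hilbert_odd p q r"] by simp
    also have "\<dots> = Legendre r q * Legendre q r"
      using q r False primes_not_dvd_int[of q r] primes_not_dvd_int[of r q]
      by (simp add: hilbert_odd_prime_unit hilbert_odd_commute[of r q r])
    also have "\<dots> = mod4_sign q r"
      using Legendre_reciprocity[OF q r False] by (simp add: mult.commute)
    finally show ?thesis .
  qed
  then show "(\<Prod>p\<in>P. hilbert_odd p q r) = hilbert_two q r * hilbert_real q r"
    using rhs by simp
qed

lemma product_formula_primes:
  assumes "prime q" "prime r"
  shows "product_formula q r"
proof -
  have "q = 2 \<or> odd q" "r = 2 \<or> odd r" using assms primes_not_dvd_int[of 2] by auto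
  then show ?thesis
    using assms product_formula_two_prime product_formula_commute product_formula_odd_primes
    by blast
qed

text \<open>A nonzero integer is a product of a sign and primes, so multiplicativity reduces the
  first argument to these.\<close>

lemma product_formula_induct:
  assumes "product_formula (-1) n" "\<And>q. prime q \<Longrightarrow> product_formula q n" "m \<noteq> 0" "n \<noteq> 0"
  shows "product_formula m n"
  using assms(3)
proof (induction m rule: prime_divisors_induct)
  case (unit x)
  then have "x = 1 \<or> x = -1" by (auto simp: zdvd1_eq)
  then show ?case using assms product_formula_one by auto
next
  case (factor p x)
  then show ?case using assms by (intro product_formula_mult) auto
qed auto

lemma hilbert_product_formula:
  assumes "m \<noteq> 0" "n \<noteq> 0"
  shows "product_formula m n"
proof -
  \<comment> \<open>The induction on the first argument runs three times, with second argument -1,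
    then a prime, then \<open>n\<close>; symmetry turns the first two results into the premises of
    the last.\<close>
  have *: "product_formula k (-1)" if "k \<noteq> 0" for k
    by (rule product_formula_induct[OF product_formula_minus_one_minus_one
          product_formula_prime_minus_one that]) simp_all
  have "product_formula k r" if "k \<noteq> 0" and r: "prime r" for k r
  proof (rule product_formula_induct)
    show "product_formula (-1) r"
      using product_formula_prime_minus_one[OF r] product_formula_commute by blast
    show "product_formula q r" if "prime q" for q using that r by (rule product_formula_primes)
    show "r \<noteq> 0" using r prime_gt_0_int by force
  qed fact
  then have "product_formula q n" if "prime q" for q
    using that assms product_formula_commute by blast
  moreover have "product_formula (-1) n" using *[OF assms(2)] product_formula_commute by blast
  ultimately show ?thesis using assms product_formula_induct by blast
qed

text \<open>The real symbol of two negative numbers is -1 and the symbol at 2 is 1, so the product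
  over the odd primes is -1 and some factor is not 1.\<close>

lemma exists_odd_prime_hilbert:
  assumes "m < 0" "n < 0" "hilbert_two m n = 1"
  obtains p where "prime p" "odd p" "hilbert_odd p m n = -1"
proof -
  let ?P = "{p. prime p \<and> odd p \<and> p dvd m * n}"
  have "finite ?P" using assms finite_divisors_int[of "m * n"]
    by (auto elim!: rev_finite_subset)
  then have "covers_odd_primes ?P (m * n)" by (auto simp: covers_odd_primes_def)
  then have "(\<Prod>p\<in>?P. hilbert_odd p m n) = -1"
    using hilbert_product_formula[of m n] assms
    by (auto simp: product_formula_def hilbert_real_def)
  then have "\<not> (\<forall>p\<in>?P. hilbert_odd p m n = 1)"
    by (metis (no_types, lifting) prod.neutral one_neq_neg_one)
  then show ?thesis using that hilbert_odd_range[of _ m n] assms by auto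
qed

subsection \<open>Residue classes missed by anisotropic forms\<close>

text \<open>Every nonzero value of the binary form has a valuation of the same parity as that of
  \<open>A\<close>. Since \<open>g\<close> has the other parity, divisibility by
  \<open>p ^ g\<close> improves by one power.\<close>

lemma binary_anisotropic_dvd:
  fixes p A B X Y :: int
  assumes p: "prime p" and AB: "A \<noteq> 0" "B \<noteq> 0"
    and parity: "even (multiplicity p A + multiplicity p B)"
    and odd: "odd (multiplicity p A + g)"
    and nonres: "Legendre (- (unit_part p A * unit_part p B)) p = -1"
    and dvd: "p ^ g dvd A * X\<^sup>2 + B * Y\<^sup>2"
  shows "p ^ Suc g dvd A * X\<^sup>2 + B * Y\<^sup>2"
proof -
  have step: "p ^ Suc g dvd U" if "U = 0 \<or> odd (multiplicity p U + g)" "p ^ g dvd U" for U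
  proof (cases "U = 0")
    case False
    then have "g \<le> multiplicity p U"
      using that p by (intro multiplicity_geI) (auto simp: not_prime_unit)
    moreover have "g \<noteq> multiplicity p U" using that False by auto
    ultimately show ?thesis by (intro multiplicity_dvd') simp
  qed auto
  have mult_sq: "multiplicity p (C * Z\<^sup>2) = multiplicity p C + 2 * multiplicity p Z"
    "unit_part p (C * Z\<^sup>2) = unit_part p C * (unit_part p Z)\<^sup>2"
    if "C \<noteq> 0" "Z \<noteq> 0" for C Z
    using that p by (simp_all add: power2_eq_square multiplicity_prime_mult unit_part_mult)
  \<comment> \<open>If the two terms have different valuations, the smaller one decides. If they
    agree, the unit parts cannot cancel modulo \<open>p\<close>, because of
    \<open>nonres\<close>.\<close>
  have "A * X\<^sup>2 + B * Y\<^sup>2 = 0 \<or> odd (multiplicity p (A * X\<^sup>2 + B * Y\<^sup>2) + g)"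
  proof (cases "X = 0 \<or> Y = 0")
    case True
    then show ?thesis using mult_sq AB parity odd by (cases "X = 0"; cases "Y = 0") auto
  next
    case False
    define s where "s = multiplicity p (A * X\<^sup>2)"
    define t where "t = multiplicity p (B * Y\<^sup>2)"
    define u where "u = unit_part p (A * X\<^sup>2)"
    define v where "v = unit_part p (B * Y\<^sup>2)"
    have nz: "A * X\<^sup>2 \<noteq> 0" "B * Y\<^sup>2 \<noteq> 0" using False AB by auto
    have eq: "A * X\<^sup>2 = p ^ s * u" "B * Y\<^sup>2 = p ^ t * v"
      unfolding s_def t_def u_def v_def by (rule unit_part_decompose)+
    have ndvd: "\<not> p dvd u" "\<not> p dvd v"
      unfolding u_def v_def by (rule unit_part_not_dvd[OF p nz(1)] unit_part_not_dvd[OF p nz(2)])+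
    have par: "odd (s + g)" "odd (t + g)"
      using parity odd False AB unfolding s_def t_def by (auto simp: mult_sq)
    have *: "multiplicity p (p ^ k * w) = k" if "\<not> p dvd w" for k w
      using that p by (intro multiplicity_eqI) (auto simp: not_prime_0 mult.commute)
    consider "s < t" | "t < s" | "s = t" by linarith
    then show ?thesis
    proof cases
      case 1
      then have "A * X\<^sup>2 + B * Y\<^sup>2 = p ^ s * (u + p ^ (t - s) * v)"
        unfolding eq by (simp add: algebra_simps flip: power_add)
      moreover have "\<not> p dvd u + p ^ (t - s) * v"
        using ndvd 1 by (simp add: dvd_add_left_iff)
      ultimately show ?thesis using * par by metis
    next
      case 2
      then have "A * X\<^sup>2 + B * Y\<^sup>2 = p ^ t * (p ^ (s - t) * u + v)"
        unfolding eq by (simp add: algebra_simps flip: power_add)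
      moreover have "\<not> p dvd p ^ (s - t) * u + v"
        using ndvd 2 by (simp add: dvd_add_right_iff)
      ultimately show ?thesis using * par by metis
    next
      case 3
      have "A * X\<^sup>2 + B * Y\<^sup>2 = p ^ s * (u + v)"
        unfolding eq 3 by (simp add: algebra_simps)
      moreover have "\<not> p dvd u + v"
      proof
        define a b x y where "a = unit_part p A" "b = unit_part p B"
          "x = unit_part p X" "y = unit_part p Y"
        assume "p dvd u + v"
        then have "p dvd a * x\<^sup>2 + b * y\<^sup>2"
          using False AB unfolding u_def v_def a_b_x_y_def by (simp add: mult_sq)
        \<comment> \<open>Multiplying by \<open>b\<close> completes a square; dividing by the square
          of the unit \<open>x\<close> then shows \<open>- (a * b)\<close> to be a square modulo
          \<open>p\<close>.\<close>
        then have "p dvd b * (a * x\<^sup>2 + b * y\<^sup>2)" by (rule dvd_mult)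
        then have cong: "[(b * y)\<^sup>2 = - (a * b) * x\<^sup>2] (mod p)"
          by (simp add: cong_iff_dvd_diff power2_eq_square algebra_simps)
        have "\<not> p dvd x" using False p unfolding a_b_x_y_def by (auto dest: unit_part_not_dvd)
        then have "coprime p x" using p by (simp add: prime_imp_coprime)
        then obtain z where "[x * z = 1] (mod p)"
          using cong_solve_coprime_int[of x p] by (auto simp: coprime_commute)
        then have "[(x * z)\<^sup>2 = 1\<^sup>2] (mod p)" by (rule cong_pow)
        then have "[- (a * b) * (x * z)\<^sup>2 = - (a * b) * 1\<^sup>2] (mod p)"
          by (rule cong_scalar_left)
        moreover have "[(b * y)\<^sup>2 * z\<^sup>2 = - (a * b) * x\<^sup>2 * z\<^sup>2] (mod p)"
          using cong by (rule cong_scalar_right)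
        ultimately have "[(b * y * z)\<^sup>2 = - (a * b)] (mod p)"
          by (metis cong_trans mult.assoc mult.right_neutral one_power2 power_mult_distrib)
        then have "QuadRes p (- (a * b))" unfolding QuadRes_def by blast
        then show False using nonres unfolding a_b_x_y_def Legendre_def by (auto split: if_splits)
      qed
      ultimately show ?thesis using * par by metis
    qed
  qed
  then show ?thesis using step dvd by blast
qed

text \<open>The modulus is required to be odd so that 8, the factor from completing the squares, is
  invertible and the missed class carries over to the original form.\<close>

definition ternary_misses :: "int \<Rightarrow> int \<Rightarrow> int \<Rightarrow> bool" where
  "ternary_misses A B C \<longleftrightarrow>
     (\<exists>M r. M > 0 \<and> odd M \<and> (\<forall>X Y Z. \<not> [A * X\<^sup>2 + B * Y\<^sup>2 + C * Z\<^sup>2 = r] (mod M)))"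

lemma ternary_misses_if_binary_anisotropic:
  assumes p: "prime p" "odd p" and nz: "A \<noteq> 0" "B \<noteq> 0" "C \<noteq> 0"
    and parity: "even (multiplicity p A + multiplicity p B)" "odd (multiplicity p A + multiplicity p C)"
    and nonres: "Legendre (- (unit_part p A * unit_part p B)) p = -1"
  shows "ternary_misses A B C"
proof -
  \<comment> \<open>The value \<open>C t\<close> is missed because \<open>A X\<^sup>2 + B Y\<^sup>2\<close> never has the parity of valuation of \<open>C\<close>.\<close>
  obtain t where t: "\<not> QuadRes p t" using exists_nonresidue p by blast
  define g where "g = multiplicity p C"
  define c where "c = unit_part p C"
  have C: "C = p ^ g * c" unfolding g_def c_def by (rule unit_part_decompose)
  have pc: "\<not> p dvd c" using p nz unfolding c_def by (intro unit_part_not_dvd)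
  have "\<not> [A * X\<^sup>2 + B * Y\<^sup>2 + C * Z\<^sup>2 = C * t] (mod p ^ Suc g)" for X Y Z
  proof
    let ?W = "A * X\<^sup>2 + B * Y\<^sup>2"
    assume "[?W + C * Z\<^sup>2 = C * t] (mod p ^ Suc g)"
    then have D: "p ^ Suc g dvd ?W - C * (t - Z\<^sup>2)"
      by (simp add: cong_iff_dvd_diff algebra_simps)
    then have "p ^ g dvd ?W - C * (t - Z\<^sup>2)" by (rule power_le_dvd) simp
    moreover have "p ^ g dvd C * (t - Z\<^sup>2)" unfolding C by simp
    ultimately have "p ^ g dvd ?W" 
      using dvd_add[of "p ^ g" "?W - C * (t - Z\<^sup>2)" "C * (t - Z\<^sup>2)"] by simp
    \<comment> \<open>The valuation \<open>g\<close> of \<open>C\<close> has the parity excluded for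
      \<open>?W\<close>. The extra power of \<open>p\<close> then passes to
      \<open>C * (t - Z\<^sup>2)\<close> and makes \<open>t\<close> a square modulo
      \<open>p\<close>.\<close>
    then have "p ^ Suc g dvd ?W"
      using binary_anisotropic_dvd[OF p(1) nz(1,2) parity(1) _ nonres] parity(2)
      unfolding g_def by blast
    then have "p ^ Suc g dvd C * (t - Z\<^sup>2)" using D dvd_diff_right_iff by blast
    then have "p dvd c * (t - Z\<^sup>2)" using p unfolding C by (auto simp: mult.assoc not_prime_0)
    then have "p dvd t - Z\<^sup>2" using pc p by (simp add: prime_dvd_mult_iff)
    then have "[Z\<^sup>2 = t] (mod p)" by (subst cong_sym_eq) (simp add: cong_iff_dvd_diff)
    then show False using t unfolding QuadRes_def by blast
  qed
  moreover have "p ^ Suc g > 0" "odd (p ^ Suc g)" using p by (simp_all add: prime_gt_0_int)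
  ultimately show ?thesis unfolding ternary_misses_def by blast
qed

lemma ternary_misses_rotate: "ternary_misses A B C \<Longrightarrow> ternary_misses B C A"
  unfolding ternary_misses_def by (simp only: add.commute[of "A * _"] add.assoc) blast

text \<open>If the three valuations have equal parity, the symbol is 1. Otherwise two coefficients
  share a parity that the third lacks, and the symbol is the Legendre symbol of minus the product of
  their unit parts. Its value -1 makes that pair anisotropic, and rotation moves it to the
  front.\<close>

lemma ternary_misses_if_hilbert_odd:
  assumes p: "prime p" "odd p" and nz: "A \<noteq> 0" "B \<noteq> 0" "C \<noteq> 0"
    and hilbert: "hilbert_odd p (- (A * C)) (- (B * C)) = -1"
  shows "ternary_misses A B C"
proof -
  define a b c where "a = unit_part p A" "b = unit_part p B" "c = unit_part p C"
  define \<alpha> \<beta> \<gamma> where "\<alpha> = multiplicity p A" "\<beta> = multiplicity p B" "\<gamma> = multiplicity p C"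
  note defs = a_b_c_def \<alpha>_\<beta>_\<gamma>_def
  have mn: "multiplicity p (- (A * C)) = \<alpha> + \<gamma>" "multiplicity p (- (B * C)) = \<beta> + \<gamma>"
    "unit_part p (- (A * C)) = - (a * c)" "unit_part p (- (B * C)) = - (b * c)"
    using p nz by (simp_all add: unit_part_uminus multiplicity_prime_mult unit_part_mult defs)
  have nd: "\<not> p dvd a" "\<not> p dvd b" "\<not> p dvd c"
    using p nz unfolding defs by (auto dest: unit_part_not_dvd)
  define L where "L x = Legendre x p" for x
  have L1: "L x ^ k = (if even k then 1 else L x)" if "\<not> p dvd x" for x k
    using Legendre_cases[OF that] unfolding L_def by (auto simp: minus_one_power_iff)
  have h: "L (-1) ^ ((\<alpha> + \<gamma>) * (\<beta> + \<gamma>)) * L (- (a * c)) ^ (\<beta> + \<gamma>) * L (- (b * c)) ^ (\<alpha> + \<gamma>) = -1"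
    using hilbert unfolding hilbert_odd_def mn L_def .
  have nd': "\<not> p dvd -1" "\<not> p dvd - (a * c)" "\<not> p dvd - (b * c)"
    using p nd not_prime_dvd_minus_one by (auto simp: prime_dvd_mult_iff)
  consider "even (\<alpha> + \<gamma>)" "even (\<beta> + \<gamma>)" | "odd (\<alpha> + \<gamma>)" "even (\<beta> + \<gamma>)"
    | "even (\<alpha> + \<gamma>)" "odd (\<beta> + \<gamma>)" | "odd (\<alpha> + \<gamma>)" "odd (\<beta> + \<gamma>)" by blast
  then show ?thesis
  proof cases
    case 1
    then show ?thesis using h nd' by (simp add: L1)
  next
    case 2
    then have "L (- (b * c)) = -1" using h nd' by (simp add: L1)
    then have "ternary_misses B C A"
      using 2 p nz unfolding L_def defs
      by (intro ternary_misses_if_binary_anisotropic[of p]) auto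
    then show ?thesis using ternary_misses_rotate by blast
  next
    case 3
    then have "L (- (a * c)) = -1" using h nd' by (simp add: L1)
    then have "ternary_misses C A B"
      using 3 p nz unfolding L_def defs
      by (intro ternary_misses_if_binary_anisotropic[of p]) (auto simp: mult.commute)
    then show ?thesis using ternary_misses_rotate by blast
  next
    case 4
    then have "L (-1) * L (- (a * c)) * L (- (b * c)) = -1" using h nd' by (simp add: L1)
    \<comment> \<open>The three arguments multiply to \<open>- (a * b)\<close> times the square of
      the unit \<open>c\<close>.\<close>
    moreover have "L (-1) * L (- (a * c)) * L (- (b * c)) = L (- (a * b) * (c * c))"
      unfolding L_def Legendre_mult[OF p, symmetric] by (simp add: algebra_simps)
    moreover have "\<dots> = L (- (a * b))"
      using Legendre_square[OF p(1) nd(3)] unfolding L_def Legendre_mult[OF p] by simp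
    ultimately have "L (- (a * b)) = -1" by simp
    then show ?thesis
      using 4 p nz unfolding L_def defs
      by (intro ternary_misses_if_binary_anisotropic[of p]) auto
  qed
qed

text \<open>Positivity makes both arguments negative, so the symbol 1 at 2, which expresses 2-adic
  isotropy, forces the symbol -1 at some odd prime.\<close>

lemma ternary_misses_if_hilbert_two:
  assumes "A > 0" "B > 0" "C > 0" "hilbert_two (- (A * C)) (- (B * C)) = 1"
  shows "ternary_misses A B C"
proof (rule exists_odd_prime_hilbert[of "- (A * C)" "- (B * C)"])
  show "ternary_misses A B C"
    if "prime p" "odd p" "hilbert_odd p (- (A * C)) (- (B * C)) = -1" for p
    using that assms by (intro ternary_misses_if_hilbert_odd[of p]) simp_all
qed (use assms in simp_all)

subsection \<open>Density\<close>

text \<open>Each of the \<open>k\<close> blocks of \<open>M\<close> consecutive integers contains a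
  member of the missed class.\<close>

lemma card_missed_class:
  fixes M k r :: nat
  assumes "M > 0" "S \<subseteq> {1..M * k}" "\<And>n. n \<in> S \<Longrightarrow> n mod M \<noteq> r mod M"
  shows "card S + k \<le> M * k"
proof -
  \<comment> \<open>The representative is taken in 1 to \<open>M\<close>, because the blocks start
    at 1 and not at 0.\<close>
  define r' where "r' = (if r mod M = 0 then M else r mod M)"
  have r': "1 \<le> r'" "r' \<le> M" "r' mod M = r mod M"
    using assms(1) by (auto simp: r'_def less_imp_le)
  define T where "T = (\<lambda>j. M * j + r') ` {..<k}"
  have "card T = k" using assms(1) unfolding T_def by (subst card_image) (auto simp: inj_on_def)
  moreover have "T \<subseteq> {1..M * k}"
  proof
    fix n assume "n \<in> T"
    then obtain j where j: "j < k" "n = M * j + r'" by (auto simp: T_def)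
    have "M * Suc j \<le> M * k" using j by (intro mult_le_mono2) auto
    then show "n \<in> {1..M * k}" using j r' by auto
  qed
  moreover have "S \<inter> T = {}" using assms(3) r' by (fastforce simp: T_def)
  moreover have "finite S" "finite T"
    using assms(2) by (auto simp: T_def intro: finite_subset)
  ultimately have "card S + k = card (S \<union> T)" by (simp add: card_Un_disjoint)
  also have "\<dots> \<le> card {1..M * k}"
    using assms(2) \<open>T \<subseteq> {1..M * k}\<close> by (intro card_mono) auto
  finally show ?thesis by simp
qed

text \<open>Along the positive multiples of \<open>M\<close> the proportion of represented numbers
  is at most \<open>1 - 1 / M\<close>, which contradicts the limit 1.\<close>

lemma not_asymptotically_universal_if_class_missed:
  assumes M: "M > 0" and miss: "\<And>x y z. \<not> [f x y z = r] (mod M)"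
  shows "\<not> asymptotically_universal f"
proof
  define R where "R N = {n::nat. 1 \<le> n \<and> n \<le> N \<and> (\<exists>x y z. int n = f x y z)}" for N
  assume "asymptotically_universal f"
  then have lim: "(\<lambda>N. real (card (R N)) / real N) \<longlonglongrightarrow> 1"
    unfolding asymptotically_universal_def R_def .
  define m where "m = nat M"
  have m: "m > 0" "int m = M" using M by (auto simp: m_def)
  have "strict_mono (\<lambda>k. m * Suc k)" using m by (auto simp: strict_mono_def)
  then have lim': "(\<lambda>k. real (card (R (m * Suc k))) / real (m * Suc k)) \<longlonglongrightarrow> 1"
    using LIMSEQ_subseq_LIMSEQ[OF lim] by (auto simp only: o_def)
  have "real (card (R (m * Suc k))) / real (m * Suc k) \<le> 1 - 1 / real m" for k
  proof -
    have "card (R (m * Suc k)) + Suc k \<le> m * Suc k"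
    \<comment> \<open>\<open>r\<close> is an arbitrary integer, so its reduced representative is
      used as the natural number.\<close>
    proof (rule card_missed_class[where r = "nat (r mod M)"])
      fix n assume "n \<in> R (m * Suc k)"
      then obtain x y z where "int n = f x y z" by (auto simp: R_def)
      then have "int n mod M \<noteq> r mod M" using miss[of x y z] by (simp add: cong_def)
      moreover have "int (nat (r mod M) mod m) = r mod M"
        using M m by (simp add: zmod_int)
      moreover have "int (n mod m) = int n mod M" using m by (simp add: zmod_int)
      ultimately show "n mod m \<noteq> nat (r mod M) mod m" by metis
    qed (use m in \<open>auto simp: R_def\<close>)
    then have "real (card (R (m * Suc k)) + Suc k) \<le> real (m * Suc k)" by (rule of_nat_mono)
    moreover have "(1 - 1 / real m) * real (m * Suc k) = real (m * Suc k) - real (Suc k)"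
      using m by (simp add: field_simps)
    ultimately have "real (card (R (m * Suc k))) \<le> (1 - 1 / real m) * real (m * Suc k)"
      by linarith
    moreover have "real (m * Suc k) > 0" using m by (simp only: of_nat_0_less_iff) simp
    ultimately show ?thesis by (simp only: pos_divide_le_eq)
  qed
  then have "1 \<le> 1 - 1 / real m" by (intro LIMSEQ_le_const2[OF lim']) auto
  then show False using m by simp
qed

text \<open>Modulo the odd \<open>M\<close> the map sending \<open>n\<close> to
  \<open>8 * n + S\<close> is invertible, so the missed class \<open>r\<close> pulls back to the
  class \<open>e * (r - S)\<close>, where \<open>e\<close> is an inverse of 8.\<close>

lemma not_asymptotically_universal_if_ternary_misses:
  assumes "ternary_misses A B C"
    and "\<And>x y z. \<exists>X Y Z. 8 * f x y z + S = A * X\<^sup>2 + B * Y\<^sup>2 + C * Z\<^sup>2"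
  shows "\<not> asymptotically_universal f"
proof -
  obtain M r where M: "M > 0" "odd M"
    and miss: "\<And>X Y Z. \<not> [A * X\<^sup>2 + B * Y\<^sup>2 + C * Z\<^sup>2 = r] (mod M)"
    using assms(1) unfolding ternary_misses_def by blast
  have "coprime (2 ^ 3) M" using M by (intro coprime_power_left_iff[THEN iffD2] disjI1) simp
  then obtain e where e: "[8 * e = 1] (mod M)"
    using cong_solve_coprime_int[of 8 M] by auto
  show ?thesis
  proof (rule not_asymptotically_universal_if_class_missed[OF M(1)])
    fix x y z
    show "\<not> [f x y z = e * (r - S)] (mod M)"
    proof
      assume "[f x y z = e * (r - S)] (mod M)"
      then have "[8 * f x y z = 8 * (e * (r - S))] (mod M)" by (rule cong_scalar_left)
      moreover have "[8 * e * (r - S) = 1 * (r - S)] (mod M)" using e by (rule cong_scalar_right)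
      ultimately have "[8 * f x y z = r - S] (mod M)"
        by (metis cong_trans mult.assoc mult_1)
      then have "[8 * f x y z + S = r - S + S] (mod M)" by (rule cong_add) simp
      moreover obtain X Y Z where "8 * f x y z + S = A * X\<^sup>2 + B * Y\<^sup>2 + C * Z\<^sup>2"
        using assms(2) by blast
      ultimately show False using miss[of X Y Z] by simp
    qed
  qed
qed

lemma triangular_complete_square: "8 * triangular x = (2 * x + 1)\<^sup>2 - 1"
proof -
  have "even (x * (x + 1))" by simp
  then have "2 * triangular x = x * (x + 1)" unfolding triangular_def by simp
  then show ?thesis by (simp add: power2_eq_square algebra_simps)
qed

subsection \<open>The 2-adic symbol of the five forms\<close>

text \<open>The symbol at 2 in terms of the odd parts \<open>u\<close>, \<open>w\<close> of its
  arguments; \<open>P\<close> and \<open>Q\<close> say whether the valuations of the first and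
  second argument are even, which is all that the exponents contribute.\<close>

definition dyadic_sign :: "int \<Rightarrow> int \<Rightarrow> bool \<Rightarrow> bool \<Rightarrow> int" where
  "dyadic_sign u w P Q =
     mod4_sign u w * (if Q then 1 else mod8_sign u) * (if P then 1 else mod8_sign w)"

lemma hilbert_two_eq_dyadic_sign:
  assumes "a \<noteq> 0" "b \<noteq> 0" "c \<noteq> 0"
  shows "hilbert_two (- (2 ^ i * a * (2 ^ k * c))) (- (2 ^ j * b * (2 ^ k * c))) =
    dyadic_sign (- (odd_part a * odd_part c)) (- (odd_part b * odd_part c))
      (even (i + k + v2 a + v2 c)) (even (j + k + v2 b + v2 c))"
proof -
  have two: "prime (2 :: int)" by simp
  have scale: "multiplicity 2 (2 ^ n * x) = n + v2 x" "unit_part 2 (2 ^ n * x) = odd_part x"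
    if "x \<noteq> 0" for n and x :: int
  proof -
    have "multiplicity 2 (2 ^ n :: int) = n"
      by (rule multiplicity_same_power) auto
    moreover from this have "unit_part 2 (2 ^ n) = 1" by (simp add: unit_part_def)
    ultimately show "multiplicity 2 (2 ^ n * x) = n + v2 x"
        "unit_part 2 (2 ^ n * x) = odd_part x"
      using that multiplicity_prime_mult[OF two, of "2 ^ n" x] unit_part_mult[OF two, of "2 ^ n" x]
      by (simp_all add: odd_part_eq_unit_part)
  qed
  have prod: "multiplicity 2 (- (2 ^ l * x * (2 ^ k * c))) = l + k + v2 x + v2 c"
      "unit_part 2 (- (2 ^ l * x * (2 ^ k * c))) = - (odd_part x * odd_part c)"
    if "x \<noteq> 0" for l and x
    using that assms multiplicity_prime_mult[OF two, of "2 ^ l * x" "2 ^ k * c"]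
      unit_part_mult[OF two, of "2 ^ l * x" "2 ^ k * c"]
    unfolding unit_part_uminus by (simp_all add: scale)
  have pow: "mod8_sign x ^ n = (if even n then 1 else mod8_sign x)" for x n
    by (auto simp: mod8_sign_def minus_one_power_iff)
  show ?thesis unfolding hilbert_two_def dyadic_sign_def prod[OF assms(1)] prod[OF assms(2)] pow ..
qed

text \<open>The powers of 2 record the scaling by completing squares: exponent 3 for a square
  variable, 0 for a triangular one.\<close>

lemma not_asymptotically_universal_if_dyadic_sign:
  fixes i j k :: nat
  assumes "a > 0" "b > 0" "c > 0"
    and "\<And>x y z. \<exists>X Y Z. 8 * f x y z + S = 2 ^ i * a * X\<^sup>2 + 2 ^ j * b * Y\<^sup>2 + 2 ^ k * c * Z\<^sup>2"
    and "dyadic_sign (- (odd_part a * odd_part c)) (- (odd_part b * odd_part c))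
      (even (i + k + v2 a + v2 c)) (even (j + k + v2 b + v2 c)) = 1"
  shows "\<not> asymptotically_universal f"
proof (rule not_asymptotically_universal_if_ternary_misses)
  show "ternary_misses (2 ^ i * a) (2 ^ j * b) (2 ^ k * c)"
    using assms hilbert_two_eq_dyadic_sign[of a b c i k j]
    by (intro ternary_misses_if_hilbert_two) simp_all
qed (rule assms(4))

text \<open>An odd square is 1 modulo 8, and \<open>4 * z\<close> is 4 modulo 8.\<close>

lemma odd_product_mod_8:
  fixes x z :: int
  assumes "odd z"
  shows "[x = - z] (mod 8) \<Longrightarrow> (- (x * z)) mod 8 = 1"
    "[x = z + 4] (mod 8) \<Longrightarrow> (- (x * z)) mod 8 = 3"
    "[- x = z + 4] (mod 8) \<Longrightarrow> (- (x * z)) mod 8 = 5"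
proof -
  have z: "z mod 8 \<in> {1, 3, 5, 7}"
    using assms unfolding insert_iff empty_iff by presburger
  have sq: "z * z mod 8 = 1" "(z + 4) * z mod 8 = 5"
  proof -
    have "z * z mod 8 = r * r mod 8" "(z + 4) * z mod 8 = (r + 4) * r mod 8" if "z mod 8 = r" for r
    proof -
      have "[z = r] (mod 8)" using that by (auto simp: cong_def)
      then show "z * z mod 8 = r * r mod 8" "(z + 4) * z mod 8 = (r + 4) * r mod 8"
        unfolding cong_def[symmetric] by (auto intro!: cong_mult cong_add)
    qed
    then show "z * z mod 8 = 1" "(z + 4) * z mod 8 = 5"
      using z by (elim insertE emptyE; simp)+
  qed
  show "[x = - z] (mod 8) \<Longrightarrow> (- (x * z)) mod 8 = 1"
    using cong_scalar_right[of x "- z" 8 "- z"] sq by (simp add: cong_def)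
  show "(- (x * z)) mod 8 = 3" if "[x = z + 4] (mod 8)"
  proof -
    have "x * z mod 8 = 5" using cong_scalar_right[OF that, of z] sq by (simp add: cong_def)
    then show ?thesis by (simp add: zmod_zminus1_eq_if)
  qed
  show "[- x = z + 4] (mod 8) \<Longrightarrow> (- (x * z)) mod 8 = 5"
    using cong_scalar_right[of "- x" "z + 4" 8 z] sq by (simp add: cong_def)
qed

text \<open>In the first case all signs are 1. In the second \<open>mod4_sign\<close> is -1 and
  exactly one factor \<open>mod8_sign\<close>, also -1, is present. In the third
  \<open>mod4_sign\<close> is 1 and the two factors -1 are both present or both absent.\<close>

lemma dyadic_sign_eq_one:
  "u mod 8 = 1 \<Longrightarrow> w mod 8 = 1 \<Longrightarrow> dyadic_sign u w P Q = 1"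
  "u mod 8 = 3 \<Longrightarrow> w mod 8 = 3 \<Longrightarrow> P \<noteq> Q \<Longrightarrow> dyadic_sign u w P Q = 1"
  "u mod 8 \<in> {3, 5} \<Longrightarrow> w mod 8 = 5 \<Longrightarrow> P = Q \<Longrightarrow> dyadic_sign u w P Q = 1"
proof -
  have m: "u mod 4 = u mod 8 mod 4" "w mod 4 = w mod 8 mod 4" by (simp_all add: mod_mod_cancel)
  show "u mod 8 = 1 \<Longrightarrow> w mod 8 = 1 \<Longrightarrow> dyadic_sign u w P Q = 1"
    "u mod 8 = 3 \<Longrightarrow> w mod 8 = 3 \<Longrightarrow> P \<noteq> Q \<Longrightarrow> dyadic_sign u w P Q = 1"
    "u mod 8 \<in> {3, 5} \<Longrightarrow> w mod 8 = 5 \<Longrightarrow> P = Q \<Longrightarrow> dyadic_sign u w P Q = 1"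
    unfolding dyadic_sign_def mod4_sign_def mod8_sign_def m by auto
qed

lemma form_complete_squares:
  "8 * form1 a b c x y z + c = 2 ^ 3 * a * x\<^sup>2 + 2 ^ 3 * b * y\<^sup>2 + 2 ^ 0 * c * (2 * z + 1)\<^sup>2"
  "8 * form2 a b c x y z + (a + b) =
    2 ^ 0 * a * (2 * x + 1)\<^sup>2 + 2 ^ 0 * b * (2 * y + 1)\<^sup>2 + 2 ^ 3 * c * z\<^sup>2"
  "8 * form3 a b c x y z + (a + b + c) =
    2 ^ 0 * a * (2 * x + 1)\<^sup>2 + 2 ^ 0 * b * (2 * y + 1)\<^sup>2 + 2 ^ 0 * c * (2 * z + 1)\<^sup>2"
  "8 * form4 a b c x y z + b = 2 ^ 3 * a * x\<^sup>2 + 2 ^ 0 * b * (2 * y + 1)\<^sup>2 + 2 ^ 3 * c * z\<^sup>2"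
  "8 * form5 a b c x y z + (b + c) =
    2 ^ 3 * a * x\<^sup>2 + 2 ^ 0 * b * (2 * y + 1)\<^sup>2 + 2 ^ 0 * c * (2 * z + 1)\<^sup>2"
proof -
  have sq: "(2 * t + 1)\<^sup>2 = 8 * triangular t + 1" for t
    using triangular_complete_square[of t] by simp
  show "8 * form1 a b c x y z + c = 2 ^ 3 * a * x\<^sup>2 + 2 ^ 3 * b * y\<^sup>2 + 2 ^ 0 * c * (2 * z + 1)\<^sup>2"
    "8 * form2 a b c x y z + (a + b) =
      2 ^ 0 * a * (2 * x + 1)\<^sup>2 + 2 ^ 0 * b * (2 * y + 1)\<^sup>2 + 2 ^ 3 * c * z\<^sup>2"
    "8 * form3 a b c x y z + (a + b + c) =
      2 ^ 0 * a * (2 * x + 1)\<^sup>2 + 2 ^ 0 * b * (2 * y + 1)\<^sup>2 + 2 ^ 0 * c * (2 * z + 1)\<^sup>2"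
    "8 * form4 a b c x y z + b = 2 ^ 3 * a * x\<^sup>2 + 2 ^ 0 * b * (2 * y + 1)\<^sup>2 + 2 ^ 3 * c * z\<^sup>2"
    "8 * form5 a b c x y z + (b + c) =
      2 ^ 3 * a * x\<^sup>2 + 2 ^ 0 * b * (2 * y + 1)\<^sup>2 + 2 ^ 0 * c * (2 * z + 1)\<^sup>2"
    unfolding form1_def form2_def form3_def form4_def form5_def sq by (simp_all add: algebra_simps)
qed

theorem corollary1p4:
  fixes a b c :: int
  assumes "a > 0" and "b > 0" and "c > 0"
  shows
    "([odd_part a = odd_part b] (mod 8) \<and> [odd_part b = - odd_part c] (mod 8)
        \<longrightarrow> \<not> asymptotically_universal (form1 a b c) \<and>
            \<not> asymptotically_universal (form2 a b c) \<and>
            \<not> asymptotically_universal (form3 a b c) \<and>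
            \<not> asymptotically_universal (form4 a b c) \<and>
            \<not> asymptotically_universal (form5 a b c))
     \<and>
     (([odd_part a = odd_part b] (mod 8) \<and> [odd_part b = odd_part c + 4] (mod 8) \<and>
         \<not> [v2 a = v2 b] (mod 2))
      \<or> ((\<exists>\<epsilon>\<in>{1, -1}. [\<epsilon> * odd_part a = - odd_part b] (mod 8) \<and>
                     [- odd_part b = odd_part c + 4] (mod 8)) \<and>
         [v2 a = v2 b] (mod 2))
        \<longrightarrow> \<not> asymptotically_universal (form1 a b c) \<and>
            \<not> asymptotically_universal (form2 a b c) \<and>
            \<not> asymptotically_universal (form3 a b c))
     \<and>
     (([odd_part a = odd_part b] (mod 8) \<and> [odd_part b = odd_part c + 4] (mod 8) \<and>
         [v2 a = v2 b] (mod 2))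
      \<or> ((\<exists>\<epsilon>\<in>{1, -1}. [\<epsilon> * odd_part a = - odd_part b] (mod 8) \<and>
                     [- odd_part b = odd_part c + 4] (mod 8)) \<and>
         \<not> [v2 a = v2 b] (mod 2))
        \<longrightarrow> \<not> asymptotically_universal (form4 a b c) \<and>
            \<not> asymptotically_universal (form5 a b c))"
proof -
  define u where "u = - (odd_part a * odd_part c)"
  define w where "w = - (odd_part b * odd_part c)"
  \<comment> \<open>\<open>P\<close> and \<open>Q\<close> are the parities contributed by the
    scaling exponents; comparing them with the parities from \<open>a\<close>, \<open>b\<close>,
    \<open>c\<close> by equality of truth values adds the parities.\<close>
  define s where "s P Q = dyadic_sign u w (P = even (v2 a + v2 c)) (Q = even (v2 b + v2 c))" for P Q
  have crit: "\<not> asymptotically_universal f" if "s P Q = 1"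
    and "\<And>x y z. \<exists>X Y Z. 8 * f x y z + S = 2 ^ i * a * X\<^sup>2 + 2 ^ j * b * Y\<^sup>2 + 2 ^ k * c * Z\<^sup>2"
    and "P = even (i + k)" "Q = even (j + k)" for f S i j k P Q
  proof (rule not_asymptotically_universal_if_dyadic_sign[OF assms that(2)])
    have "even (i + k + v2 a + v2 c) = (P = even (v2 a + v2 c))"
      "even (j + k + v2 b + v2 c) = (Q = even (v2 b + v2 c))"
      unfolding that(3,4) by auto
    then show "dyadic_sign (- (odd_part a * odd_part c)) (- (odd_part b * odd_part c))
        (even (i + k + v2 a + v2 c)) (even (j + k + v2 b + v2 c)) = 1"
      using that(1) by (simp only: s_def u_def w_def)
  qed
  \<comment> \<open>The exponents 3 and 0 give equal parities \<open>P\<close> and \<open>Q\<close>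
    for forms 1 to 3 and different ones for forms 4 and 5. This separates the second and third
    claims.\<close>
  have f1: "\<not> asymptotically_universal (form1 a b c)" if "s False False = 1"
    by (rule crit[OF that, where i = 3 and j = 3 and k = 0])
      (use form_complete_squares(1) in blast, simp_all)
  have f2: "\<not> asymptotically_universal (form2 a b c)" if "s False False = 1"
    by (rule crit[OF that, where i = 0 and j = 0 and k = 3])
      (use form_complete_squares(2) in blast, simp_all)
  have f3: "\<not> asymptotically_universal (form3 a b c)" if "s True True = 1"
    by (rule crit[OF that, where i = 0 and j = 0 and k = 0])
      (use form_complete_squares(3) in blast, simp_all)
  have f4: "\<not> asymptotically_universal (form4 a b c)" if "s True False = 1"
    by (rule crit[OF that, where i = 3 and j = 0 and k = 3])
      (use form_complete_squares(4) in blast, simp_all)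
  have f5: "\<not> asymptotically_universal (form5 a b c)" if "s False True = 1"
    by (rule crit[OF that, where i = 3 and j = 0 and k = 0])
      (use form_complete_squares(5) in blast, simp_all)
  have "odd (odd_part c)"
    unfolding odd_part_eq_unit_part using assms(3) by (intro unit_part_not_dvd) auto
  note mods = odd_product_mod_8[OF this, where x = "odd_part a", folded u_def]
    odd_product_mod_8[OF this, where x = "odd_part b", folded w_def]
  \<comment> \<open>The valuation of \<open>c\<close> occurs in both sums and cancels.\<close>
  have v: "[v2 a = v2 b] (mod 2) \<longleftrightarrow> (even (v2 a + v2 c) = even (v2 b + v2 c))"
    by (auto simp: cong_def even_iff_mod_2_eq_zero[symmetric] mod2_eq_if)
  have case1: "s P Q = 1"
    if "[odd_part a = odd_part b] (mod 8)" "[odd_part b = - odd_part c] (mod 8)" for P Q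
    unfolding s_def using that mods(4) mods(1)[OF cong_trans[OF that]] by (intro dyadic_sign_eq_one(1))
  have case2: "s P Q = 1"
    if "[odd_part a = odd_part b] (mod 8)" "[odd_part b = odd_part c + 4] (mod 8)"
      "[v2 a = v2 b] (mod 2) \<longleftrightarrow> P \<noteq> Q" for P Q
    unfolding s_def using that(3) v
    by (intro dyadic_sign_eq_one(2) mods(2)[OF cong_trans[OF that(1,2)]] mods(5)[OF that(2)]) auto
  have case3: "s P Q = 1"
    if ex: "\<exists>\<epsilon>\<in>{1, -1}. [\<epsilon> * odd_part a = - odd_part b] (mod 8) \<and>
          [- odd_part b = odd_part c + 4] (mod 8)"
      and "[v2 a = v2 b] (mod 2) \<longleftrightarrow> P = Q" for P Q
  proof -
    have b: "[- odd_part b = odd_part c + 4] (mod 8)" using ex by blast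
    have "[odd_part a = - odd_part b] (mod 8) \<or> [- odd_part a = - odd_part b] (mod 8)"
      using ex by auto
    \<comment> \<open>The sign 1 gives the residue 3 and the sign -1 the residue 5.\<close>
    then have "u mod 8 \<in> {3, 5}" using mods(2,3) cong_trans[OF _ b] by blast
    then show ?thesis
      unfolding s_def using that(2) v by (intro dyadic_sign_eq_one(3) mods(6)[OF b]) auto
  qed
  have same: "s False False = 1 \<and> s True True = 1"
    if "[odd_part a = odd_part b] (mod 8) \<and> [odd_part b = odd_part c + 4] (mod 8) \<and>
         \<not> [v2 a = v2 b] (mod 2)
      \<or> (\<exists>\<epsilon>\<in>{1, -1}. [\<epsilon> * odd_part a = - odd_part b] (mod 8) \<and>
           [- odd_part b = odd_part c + 4] (mod 8)) \<and> [v2 a = v2 b] (mod 2)"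
    using that
  proof (elim disjE conjE)
    assume *: "[odd_part a = odd_part b] (mod 8)" "[odd_part b = odd_part c + 4] (mod 8)"
      "\<not> [v2 a = v2 b] (mod 2)"
    show ?thesis by (intro conjI case2[OF *(1,2)]) (use *(3) in auto)
  next
    assume *: "\<exists>\<epsilon>\<in>{1, -1}. [\<epsilon> * odd_part a = - odd_part b] (mod 8) \<and>
        [- odd_part b = odd_part c + 4] (mod 8)" "[v2 a = v2 b] (mod 2)"
    show ?thesis by (intro conjI case3[OF *(1)]) (use *(2) in auto)
  qed
  have different: "s True False = 1 \<and> s False True = 1"
    if "[odd_part a = odd_part b] (mod 8) \<and> [odd_part b = odd_part c + 4] (mod 8) \<and>
         [v2 a = v2 b] (mod 2)
      \<or> (\<exists>\<epsilon>\<in>{1, -1}. [\<epsilon> * odd_part a = - odd_part b] (mod 8) \<and>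
           [- odd_part b = odd_part c + 4] (mod 8)) \<and> \<not> [v2 a = v2 b] (mod 2)"
    using that
  proof (elim disjE conjE)
    assume *: "[odd_part a = odd_part b] (mod 8)" "[odd_part b = odd_part c + 4] (mod 8)"
      "[v2 a = v2 b] (mod 2)"
    show ?thesis by (intro conjI case2[OF *(1,2)]) (use *(3) in auto)
  next
    assume *: "\<exists>\<epsilon>\<in>{1, -1}. [\<epsilon> * odd_part a = - odd_part b] (mod 8) \<and>
        [- odd_part b = odd_part c + 4] (mod 8)" "\<not> [v2 a = v2 b] (mod 2)"
    show ?thesis by (intro conjI case3[OF *(1)]) (use *(2) in auto)
  qed
  show ?thesis
    by (intro conjI impI f1 f2 f3 f4 f5;
        (elim conjE, rule case1; assumption
          | drule same, elim conjE, assumption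
          | drule different, elim conjE, assumption))
qed

end
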